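(* Let $p$ be a prime, $q$ a power of $p$, and $m \in \mathbb{F}_q$. For $d \geq 1$ let $M_d = (a_{i,j})_{0 \le i,j \le p^d - 1}$ be the $p^d \times p^d$ matrix over $\mathbb{F}_q$ defined by $a_{i,0} = a_{0,j} = 1$ and $a_{i,j} = a_{i-1,j} + m\, a_{i-1,j-1} + a_{i,j-1}$ for $i,j \geq 1$, and let $F = M_1$. Then for all $d \geq 1$, \[ M_d = \varphi^{d-1}(F) \otimes \varphi^{d-2}(F) \otimes \dots \otimes \varphi(F) \otimes F. \]
   Context: $\varphi(x) = x^p$ is the Frobenius automorphism of $\mathbb{F}_q$; for a matrix $A = (a_{i,j})$, $\varphi(A) = (\varphi(a_{i,j}))$, and $\varphi^0(F) = F$. For matrices $A = (a_{i,j}) \in \mathcal{M}_{s\times t}$ and $B \in \mathcal{M}_{u \times v}$, the tensor product $A \otimes B \in \mathcal{M}_{su \times tv}$ is the matrix with block representation $(a_{i,j} B)$. An iterated product $A_1 \otimes A_2 \otimes \dots \otimes A_n$ means $((\dots(A_1 \otimes A_2)\otimes A_3)\dots)\otimes A_n$. For $d=1$ the right-hand side is just $F$. *)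

theory Defs
  imports "Jordan_Normal_Form.Matrix" "HOL-Library.Cardinality" "HOL-Computational_Algebra.Primes"
begin

fun rec_entry :: "'a::comm_ring_1 \<Rightarrow> nat \<Rightarrow> nat \<Rightarrow> 'a" where
  "rec_entry m i 0 = 1"
| "rec_entry m 0 (Suc j) = 1"
| "rec_entry m (Suc i) (Suc j) =
     rec_entry m i (Suc j) + m * rec_entry m i j + rec_entry m (Suc i) j"

definition rec_mat :: "nat \<Rightarrow> 'a::comm_ring_1 \<Rightarrow> nat \<Rightarrow> 'a mat" where
  "rec_mat p m d = mat (p ^ d) (p ^ d) (\<lambda>(i, j). rec_entry m i j)"

definition frob :: "nat \<Rightarrow> 'a::comm_ring_1 \<Rightarrow> 'a" where
  "frob p x = x ^ p"

text \<open>Row \<open>i * dim_row B + k\<close> and column \<open>j * dim_col B + l\<close> address entry \<open>(k, l)\<close> of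
  the \<open>(i, j)\<close> block, which is the scalar multiple of \<open>B\<close> by the entry \<open>(i, j)\<close> of \<open>A\<close>.\<close>

definition tensor_mat :: "'a::comm_ring_1 mat \<Rightarrow> 'a mat \<Rightarrow> 'a mat" (infixl "\<otimes>\<^sub>m" 70) where
  "A \<otimes>\<^sub>m B = mat (dim_row A * dim_row B) (dim_col A * dim_col B)
     (\<lambda>(i, j). A $$ (i div dim_row B, j div dim_col B) * B $$ (i mod dim_row B, j mod dim_col B))"

lemma tensor_mat_block:
  assumes "i < dim_row A" "j < dim_col A" "k < dim_row B" "l < dim_col B"
  shows "(A \<otimes>\<^sub>m B) $$ (i * dim_row B + k, j * dim_col B + l) = (A $$ (i, j) \<cdot>\<^sub>m B) $$ (k, l)"
proof -
  have bound: "a * n + b < c * n" if "a < c" "b < n" for a b c n :: nat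
  proof -
    have "a * n + b < Suc a * n" using that by simp
    also have "\<dots> \<le> c * n" using that by (intro mult_le_mono1) simp
    finally show ?thesis .
  qed
  show ?thesis
    using assms bound[OF assms(1,3)] bound[OF assms(2,4)] by (simp add: tensor_mat_def)
qed

text \<open>The product is bracketed to the left; the value on the empty list is a totality
  convention.\<close>

fun tensor_list :: "'a::comm_ring_1 mat list \<Rightarrow> 'a mat" where
  "tensor_list [] = 1\<^sub>m 1"
| "tensor_list (A # As) = foldl (\<otimes>\<^sub>m) A As"

end

theory Submission
  imports Defs "HOL-Computational_Algebra.Formal_Laurent_Series"
    "HOL-Computational_Algebra.Polynomial_FPS" "HOL-Number_Theory.Residues"
begin

text \<open>
  The \<open>i\<close>-th row of the recursive array has generating function
  \<open>(1 + m X)\<^sup>i / (1 - X)\<^sup>i\<^sup>+\<^sup>1\<close>. In characteristic \<open>p\<close>, for \<open>r < p\<close>, the row \<open>i p + r\<close> therefore has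
  generating function
  \<open>(1 + m X)\<^sup>r (1 - X)\<^sup>p\<^sup>-\<^sup>1\<^sup>-\<^sup>r\<close> times \<open>(1 + m\<^sup>p X\<^sup>p)\<^sup>i / (1 - X\<^sup>p)\<^sup>i\<^sup>+\<^sup>1\<close>. The first factor is a polynomial
  of degree less than \<open>p\<close>, and the second one is the row \<open>i\<close> for the parameter \<open>m\<^sup>p\<close>, evaluated
  at \<open>X\<^sup>p\<close>. Comparing coefficients shows that the entry at \<open>(i p + r, j p + s)\<close> is the
  Frobenius image of the entry at \<open>(i, j)\<close> times the entry at \<open>(r, s)\<close>, so that
  \<open>M\<^sub>d\<^sub>+\<^sub>1\<close> is \<open>\<phi>(M\<^sub>d) \<otimes> F\<close>.
\<close>

definition rec_row :: "'a::comm_ring_1 \<Rightarrow> nat \<Rightarrow> 'a fps" where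
  "rec_row m i = Abs_fps (rec_entry m i)"

lemma rec_row_nth [simp]: "fps_nth (rec_row m i) j = rec_entry m i j"
  by (simp add: rec_row_def)

lemma rec_entry_0_left [simp]: "rec_entry m 0 j = 1"
  by (cases j) auto

lemma rec_row_0: "(1 - fps_X) * rec_row m 0 = 1"
proof (rule fps_ext)
  fix n
  show "fps_nth ((1 - fps_X) * rec_row m 0) n = fps_nth 1 n"
    by (cases n) (auto simp: algebra_simps)
qed

text \<open>Moving the term from the same row to the left, the recursion says that two adjacent
  coefficients of row \<open>Suc i\<close> differ by a coefficient of the right-hand side; index 0
  is the column of ones.\<close>

lemma rec_row_Suc:
  "(1 - fps_X) * rec_row m (Suc i) = (1 + fps_const m * fps_X) * rec_row m i"
proof (rule fps_ext)
  fix n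
  show "fps_nth ((1 - fps_X) * rec_row m (Suc i)) n =
      fps_nth ((1 + fps_const m * fps_X) * rec_row m i) n"
    by (cases n) (auto simp: algebra_simps)
qed

lemma rec_row_closed_form:
  "(1 - fps_X) ^ Suc i * rec_row m i = (1 + fps_const m * fps_X) ^ i"
proof (induction i)
  case 0
  then show ?case by (simp add: rec_row_0)
next
  case (Suc i)
  have "(1 - fps_X) ^ Suc (Suc i) * rec_row m (Suc i) =
      (1 - fps_X) ^ Suc i * ((1 - fps_X) * rec_row m (Suc i))"
    by (simp add: ac_simps)
  also have "\<dots> = (1 + fps_const m * fps_X) * ((1 - fps_X) ^ Suc i * rec_row m i)"
    by (simp only: rec_row_Suc mult.left_commute)
  finally show ?case unfolding Suc.IH by simp
qed

text \<open>In characteristic \<open>p\<close> the Frobenius map respects sums and products, and the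
  recursion uses nothing else.\<close>

lemma frob_rec_entry:
  fixes m :: "'a::idom"
  assumes "prime p" "CHAR('a) = p"
  shows "frob p (rec_entry m i j) = rec_entry (frob p m) i j"
proof (induction m i j rule: rec_entry.induct)
  case (3 m i j)
  have add: "(x + y) ^ p = x ^ p + y ^ p" for x y :: 'a
    using assms by (intro freshmans_dream) simp_all
  show ?case
    using 3 by (simp add: frob_def add power_mult_distrib)
qed (simp_all add: frob_def)

lemma fps_one_plus_const_X_power_CHAR:
  fixes c :: "'a::idom"
  assumes "prime p" "CHAR('a) = p"
  shows "(1 + fps_const c * fps_X) ^ p = 1 + fps_const (c ^ p) * fps_X ^ p"
proof -
  have "(1 + fps_const c * fps_X) ^ p = 1 ^ p + (fps_const c * fps_X) ^ p"
    by (rule freshmans_dream) (use assms in auto)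
  then show ?thesis
    by (simp only: power_one power_mult_distrib fps_const_power)
qed

lemma fps_one_minus_X_power_CHAR:
  assumes "prime p" "CHAR('a::idom) = p"
  shows "(1 - fps_X :: 'a fps) ^ p = 1 - fps_X ^ p"
proof -
  \<comment> \<open>Splitting 1 as a sum avoids the sign (-1)^p and hence a separate case for p =
    2.\<close>
  have "(1 - fps_X + fps_X :: 'a fps) ^ p = (1 - fps_X) ^ p + fps_X ^ p"
    by (rule freshmans_dream) (use assms in auto)
  then show ?thesis
    by (simp only: diff_add_cancel power_one eq_diff_eq)
qed

text \<open>For p > 0 the series X^p has zero constant term, so substituting it is compatible with
  sums and products and can be applied to both sides of the closed form.\<close>

lemma rec_row_compose_X_power:
  fixes m :: "'a::idom"
  assumes "0 < p"
  shows "(1 - fps_X ^ p) ^ Suc i * (rec_row m i oo fps_X ^ p) =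
    (1 + fps_const m * fps_X ^ p) ^ i"
proof -
  have X0: "fps_nth (fps_X ^ p :: 'a fps) 0 = 0"
    using assms by simp
  have "((1 - fps_X) ^ Suc i * rec_row m i) oo fps_X ^ p =
      (1 + fps_const m * fps_X) ^ i oo fps_X ^ p"
    by (simp only: rec_row_closed_form)
  then show ?thesis
    using X0
    by (simp add: fps_compose_mult_distrib fps_compose_power[symmetric] fps_compose_add_distrib
        fps_compose_sub_distrib del: power_Suc fps_X_power_nth)
qed

lemma rec_row_lucas:
  fixes m :: "'a::idom"
  assumes "prime p" "CHAR('a) = p" "r < p"
  shows "rec_row m (i * p + r) =
    fps_of_poly ([:1, m:] ^ r * [:1, -1:] ^ (p - Suc r)) * (rec_row (frob p m) i oo fps_X ^ p)"
    (is "?R = ?P * ?C")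
proof -
  let ?u = "1 - fps_X :: 'a fps" and ?v = "1 + fps_const m * fps_X"
  have P: "?P = ?v ^ r * ?u ^ (p - Suc r)"
    by (simp add: fps_of_poly_mult fps_of_poly_power fps_of_poly_pCons)
  \<comment> \<open>Adding p - 1 - r factors makes the exponent of the denominator a multiple of p,
    so the freshman's dream applies; the added factors reappear in \<open>?P\<close>.\<close>
  have exponent: "p * Suc i = Suc (i * p + r) + (p - Suc r)"
    using assms(3) by simp
  have u: "?u ^ (p * Suc i) = (1 - fps_X ^ p) ^ Suc i"
    using assms by (simp only: power_mult fps_one_minus_X_power_CHAR)
  have v: "?v ^ (i * p) = (1 + fps_const (frob p m) * fps_X ^ p) ^ i"
    using assms by (simp only: mult.commute[of i] power_mult fps_one_plus_const_X_power_CHAR frob_def)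
  have "?u ^ (p * Suc i) * ?R = ?u ^ (p - Suc r) * (?u ^ Suc (i * p + r) * ?R)"
    unfolding exponent power_add by (simp only: ac_simps)
  also have "\<dots> = ?v ^ (i * p) * ?P"
    unfolding rec_row_closed_form P power_add by (simp only: ac_simps)
  also have "\<dots> = ?u ^ (p * Suc i) * (?P * ?C)"
    unfolding u v rec_row_compose_X_power[OF prime_gt_0_nat[OF assms(1)], symmetric]
    by (simp only: ac_simps)
  finally have "?u ^ (p * Suc i) * ?R = ?u ^ (p * Suc i) * (?P * ?C)" .
  \<comment> \<open>The constant term of \<open>?u\<close> is 1, so \<open>?u\<close> is nonzero and
    its powers cancel in the domain of power series.\<close>
  moreover have "fps_nth ?u 0 \<noteq> fps_nth 0 0"
    by simp
  then have "?u \<noteq> 0"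
    by metis
  ultimately show ?thesis
    by simp
qed

text \<open>A term of the convolution survives only if k < p, by the degree bound, and k is
  congruent to s modulo p. As s < p, this forces k = s.\<close>

lemma fps_nth_poly_times_compose_X_power:
  fixes f :: "'a::idom fps"
  assumes "degree P < p" "s < p"
  shows "fps_nth (fps_of_poly P * (f oo fps_X ^ p)) (j * p + s) = Polynomial.coeff P s * fps_nth f j"
proof -
  have "fps_nth (fps_of_poly P * (f oo fps_X ^ p)) (j * p + s) =
      (\<Sum>k=0..j * p + s. Polynomial.coeff P k * (if p dvd j * p + s - k then fps_nth f ((j * p + s - k) div p) else 0))"
    by (simp add: fps_mult_nth fps_nth_compose_X_power)
  also have "\<dots> = (\<Sum>k\<in>{s}. Polynomial.coeff P k * (if p dvd j * p + s - k then fps_nth f ((j * p + s - k) div p) else 0))"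
  proof (rule sum.mono_neutral_right)
    show "\<forall>k\<in>{0..j * p + s} - {s}. Polynomial.coeff P k *
        (if p dvd j * p + s - k then fps_nth f ((j * p + s - k) div p) else 0) = 0"
    proof
      fix k assume k: "k \<in> {0..j * p + s} - {s}"
      show "Polynomial.coeff P k * (if p dvd j * p + s - k then fps_nth f ((j * p + s - k) div p) else 0) = 0"
      proof (cases "k < p \<and> p dvd j * p + s - k")
        case True
        then have "(j * p + s) mod p = k mod p"
          using k mod_eq_dvd_iff_nat[of k "j * p + s" p] by simp
        then show ?thesis
          using True k assms(2) by simp
      next
        case False
        then show ?thesis
          using assms(1) by (auto simp: Polynomial.coeff_eq_0)
      qed
    qed
  qed auto
  finally show ?thesis
    using assms by simp
qed

lemma rec_entry_lucas:
  fixes m :: "'a::idom"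
  assumes "prime p" "CHAR('a) = p" "r < p" "s < p"
  shows "rec_entry m (i * p + r) (j * p + s) = rec_entry (frob p m) i j * rec_entry m r s"
proof -
  let ?P = "[:1, m:] ^ r * [:1, -1:] ^ (p - Suc r)"
  have "degree ?P \<le> degree ([:1, m:] ^ r) + degree ([:1, -1::'a:] ^ (p - Suc r))"
    by (rule degree_mult_le)
  also have "\<dots> \<le> degree [:1, m:] * r + degree [:1, -1::'a:] * (p - Suc r)"
    by (intro add_mono degree_power_le)
  also have "\<dots> \<le> 1 * r + 1 * (p - Suc r)"
    by (intro add_mono mult_right_mono) auto
  finally have deg: "degree ?P < p"
    using assms(3) by simp
  have entry: "rec_entry m (i * p + r) (j * p + s) = Polynomial.coeff ?P s * rec_entry (frob p m) i j" for i j
    using fps_nth_poly_times_compose_X_power[OF deg assms(4), of "rec_row (frob p m) i" j]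
    by (simp only: rec_row_lucas[OF assms(1-3), symmetric] rec_row_nth)
  \<comment> \<open>The block at (0, 0) carries the factor 1, so it identifies the coefficients of
    \<open>?P\<close> without expanding the product.\<close>
  from entry[of 0 0] have "rec_entry m r s = Polynomial.coeff ?P s"
    by simp
  then show ?thesis
    by (simp add: entry[of i j] mult.commute)
qed

lemma rec_mat_Suc:
  fixes m :: "'a::idom"
  assumes "prime p" "CHAR('a) = p"
  shows "rec_mat p m (Suc d) = rec_mat p (frob p m) d \<otimes>\<^sub>m rec_mat p m 1"
proof (rule eq_matI)
  fix i j
  assume "i < dim_row (rec_mat p (frob p m) d \<otimes>\<^sub>m rec_mat p m 1)"
    and "j < dim_col (rec_mat p (frob p m) d \<otimes>\<^sub>m rec_mat p m 1)"
  then have ij: "i < p ^ d * p" "j < p ^ d * p"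
    by (simp_all add: tensor_mat_def rec_mat_def)
  moreover have "i mod p < p" "j mod p < p"
    using prime_gt_0_nat[OF assms(1)] by simp_all
  moreover have "i div p < p ^ d" "j div p < p ^ d"
    using ij by (simp_all add: less_mult_imp_div_less)
  ultimately show "rec_mat p m (Suc d) $$ (i, j) =
      (rec_mat p (frob p m) d \<otimes>\<^sub>m rec_mat p m 1) $$ (i, j)"
    using rec_entry_lucas[OF assms, of "i mod p" "j mod p" m "i div p" "j div p"]
    by (simp add: tensor_mat_def rec_mat_def mult.commute[of p])
qed (simp_all add: tensor_mat_def rec_mat_def)

lemma map_mat_frob_rec_mat:
  fixes m :: "'a::idom"
  assumes "prime p" "CHAR('a) = p"
  shows "map_mat (frob p ^^ k) (rec_mat p m d) = rec_mat p ((frob p ^^ k) m) d"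
proof -
  have "(frob p ^^ k) (rec_entry m i j) = rec_entry ((frob p ^^ k) m) i j" for i j
    by (induction k) (simp_all add: frob_rec_entry[OF assms])
  then show ?thesis
    by (auto simp: rec_mat_def)
qed

lemma tensor_list_snoc:
  "As \<noteq> [] \<Longrightarrow> tensor_list (As @ [B]) = tensor_list As \<otimes>\<^sub>m B"
  by (cases As) auto

text \<open>Induction on \<open>d\<close> splits off the last factor. The parameter \<open>m\<close>
  must vary, because the remaining matrix has parameter \<open>frob p m\<close>.\<close>

lemma rec_mat_eq_tensor_list:
  fixes m :: "'a::idom"
  assumes "prime p" "CHAR('a) = p" "d \<ge> 1"
  shows "rec_mat p m d = tensor_list (map (\<lambda>k. rec_mat p ((frob p ^^ k) m) 1) (rev [0..<d]))"
  using assms(3)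
proof (induction d arbitrary: m rule: dec_induct)
  case base
  then show ?case by simp
next
  case (step d)
  \<comment> \<open>Index 0 becomes the last factor after reversal; shifting the other indices down
    by one moves one Frobenius into the parameter.\<close>
  have "[0..<Suc d] = 0 # map Suc [0..<d]"
    by (simp add: upt_conv_Cons map_Suc_upt del: upt_Suc)
  then have "map (\<lambda>k. rec_mat p ((frob p ^^ k) m) 1) (rev [0..<Suc d]) =
      map (\<lambda>k. rec_mat p ((frob p ^^ k) (frob p m)) 1) (rev [0..<d]) @ [rec_mat p m 1]"
    by (simp add: rev_map funpow_swap1 del: upt_Suc)
  then show ?case
    using step.IH[of "frob p m"] step.hyps
    by (simp add: tensor_list_snoc rec_mat_Suc[OF assms(1,2), of m d] del: upt_Suc)
qed

lemma CHAR_eq_prime_of_CARD_prime_power: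
  assumes "prime p" "CARD('a::{field, finite}) = p ^ k"
  shows "CHAR('a) = p"
proof -
  have "prime CHAR('a)"
    by (intro prime_CHAR_semidom finite_imp_CHAR_pos) simp
  moreover have "CHAR('a) dvd p ^ k"
    using CHAR_dvd_CARD[where ?'a = 'a] assms(2) by simp
  ultimately show ?thesis
    using assms(1) prime_dvd_power primes_dvd_imp_eq by blast
qed

theorem theorem3p7:
  fixes p q :: nat and m :: "'a :: {field, finite}"
  assumes "prime p" and "\<exists>k\<ge>1. q = p ^ k" and "CARD('a) = q"
  shows "\<forall>d\<ge>1. rec_mat p m d =
    tensor_list (map (\<lambda>k. map_mat (frob p ^^ k) (rec_mat p m 1)) (rev [0..<d]))"
proof -
  have "CHAR('a) = p"
    using assms CHAR_eq_prime_of_CARD_prime_power by blast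
  note char = assms(1) this
  show ?thesis
    unfolding map_mat_frob_rec_mat[OF char] by (intro allI impI rec_mat_eq_tensor_list[OF char])
qed

end
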